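(* The Riemannian distance between any two distinct curves $\gamma_1$ and $\gamma_2$ in $\mathcal{A}$, in the metric $\langle\!\langle u,v\rangle\!\rangle_\eta=\int_{-1}^1\langle u(s),v(s)\rangle\,ds$, is always positive.
   Context: Fix $N\ge 2$ and $m\ge4$. For integers $j,k\ge 0$ and $\eta\colon[-1,1]\to\mathbb{R}^N$ put $\lVert \eta\rVert_{j,k}^2=\int_{-1}^1(1-s^2)^j\lvert\partial_s^k\eta(s)\rvert^2\,ds$. $\mathcal{K}^m$ is the Hilbert space of odd curves $\eta\colon[-1,1]\to\mathbb{R}^N$ ($\eta(-s)=-\eta(s)$) with $\lVert\eta\rVert_{j,j}<\infty$ for $0\le j\le m$, with squared norm $\sum_{j=0}^m\lVert\eta\rVert_{j,j}^2$. $\mathcal{A}=\mathcal{A}^m=\{\eta\in\mathcal{K}^m:\lvert\eta'\rvert\equiv1\}$, a smooth submanifold of $\mathcal{K}^m$ with tangent spaces $T_\gamma\mathcal{A}=\{v\in\mathcal{K}^m:\langle v',\gamma'\rangle\equiv0\}$. The Riemannian distance between $\gamma_1,\gamma_2\in\mathcal{A}$ is the infimum of lengths $L(\eta)=\int_0^1\big(\int_{-1}^1\lvert\eta_t(t,s)\rvert^2\,ds\big)^{1/2}dt$ over piecewise $C^1$ paths $\eta\colon[0,1]\to\mathcal{A}$ with $\eta(0)=\gamma_1$, $\eta(1)=\gamma_2$ (with the infimum over the empty set being $+\infty$). *)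

theory Defs
  imports "HOL-Analysis.Analysis"
begin

text \<open>Curves on \<open>[-1,1]\<close> are represented by functions on the real line that vanish off
  \<open>[-1,1]\<close>, so that equality of curves is equality of functions.\<close>

definition test_function :: "(real \<Rightarrow> real) \<Rightarrow> bool" where
  "test_function \<phi> \<longleftrightarrow>
     (\<forall>k x. ((deriv ^^ k) \<phi>) differentiable (at x)) \<and>
     (\<exists>a b. -1 < a \<and> b < 1 \<and> (\<forall>x. x \<notin> {a..b} \<longrightarrow> \<phi> x = 0))"

definition locally_integrable :: "(real \<Rightarrow> real ^ 'n) \<Rightarrow> bool" where
  "locally_integrable f \<longleftrightarrow>
     (\<forall>a b. -1 < a \<and> b < 1 \<longrightarrow> set_integrable lebesgue {a..b} f)"

definition is_weak_deriv :: "(real \<Rightarrow> real ^ 'n) \<Rightarrow> (real \<Rightarrow> real ^ 'n) \<Rightarrow> bool" where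
  "is_weak_deriv f g \<longleftrightarrow>
     locally_integrable f \<and> locally_integrable g \<and>
     (\<forall>\<phi>. test_function \<phi> \<longrightarrow>
        set_lebesgue_integral lebesgue {-1<..<1} (\<lambda>s. deriv \<phi> s *\<^sub>R f s) =
        - set_lebesgue_integral lebesgue {-1<..<1} (\<lambda>s. \<phi> s *\<^sub>R g s))"

text \<open>The derivatives \<open>\<partial>\<^sub>s\<^sup>k \<eta>\<close> in the weak sense on \<open>(-1,1)\<close>; for \<open>k > 0\<close> the chosen function is
  determined up to null sets, provided it exists.\<close>

primrec wderiv :: "nat \<Rightarrow> (real \<Rightarrow> real ^ 'n) \<Rightarrow> (real \<Rightarrow> real ^ 'n)" where
  "wderiv 0 \<eta> = \<eta>"
| "wderiv (Suc k) \<eta> = (SOME g. is_weak_deriv (wderiv k \<eta>) g)"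

definition wnorm_sq :: "nat \<Rightarrow> nat \<Rightarrow> (real \<Rightarrow> real ^ 'n) \<Rightarrow> real" where
  "wnorm_sq j k \<eta> =
     set_lebesgue_integral lebesgue {-1..1} (\<lambda>s. (1 - s\<^sup>2) ^ j * (norm (wderiv k \<eta> s))\<^sup>2)"

definition wnorm_finite :: "nat \<Rightarrow> nat \<Rightarrow> (real \<Rightarrow> real ^ 'n) \<Rightarrow> bool" where
  "wnorm_finite j k \<eta> \<longleftrightarrow>
     set_integrable lebesgue {-1..1} (\<lambda>s. (1 - s\<^sup>2) ^ j * (norm (wderiv k \<eta> s))\<^sup>2)"

text \<open>For the orders \<open>m \<ge> 4\<close> of interest, Hardy's inequality shows that finiteness of the norms
  puts \<open>\<eta>\<close> in \<open>H\<^sup>2(-1,1)\<close>, hence every almost-everywhere class has exactly one continuous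
  representative on \<open>[-1,1]\<close>, which is moreover continuously differentiable up to the
  endpoints. Elements of the space are taken to be these representatives.\<close>

definition K_space :: "nat \<Rightarrow> (real \<Rightarrow> real ^ 'n) set" where
  "K_space m = {\<eta>.
     (\<forall>s. s \<notin> {-1..1} \<longrightarrow> \<eta> s = 0) \<and>
     continuous_on {-1..1} \<eta> \<and>
     (\<forall>s\<in>{-1..1}. \<eta> (-s) = - \<eta> s) \<and>
     (\<forall>j<m. is_weak_deriv (wderiv j \<eta>) (wderiv (Suc j) \<eta>)) \<and>
     (\<forall>j\<le>m. wnorm_finite j j \<eta>)}"

definition K_norm :: "nat \<Rightarrow> (real \<Rightarrow> real ^ 'n) \<Rightarrow> real" where
  "K_norm m \<eta> = sqrt (\<Sum>j\<le>m. wnorm_sq j j \<eta>)"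

definition A_space :: "nat \<Rightarrow> (real \<Rightarrow> real ^ 'n) set" where
  "A_space m = {\<eta> \<in> K_space m.
     \<forall>s\<in>{-1..1}. \<exists>d. (\<eta> has_vector_derivative d) (at s within {-1..1}) \<and> norm d = 1}"

definition K_continuous_on :: "nat \<Rightarrow> real set \<Rightarrow> (real \<Rightarrow> real \<Rightarrow> real ^ 'n) \<Rightarrow> bool" where
  "K_continuous_on m T \<eta> \<longleftrightarrow>
     (\<forall>t\<in>T. ((\<lambda>r. K_norm m (\<lambda>s. \<eta> r s - \<eta> t s)) \<longlongrightarrow> 0) (at t within T))"

definition K_has_derivative ::
  "nat \<Rightarrow> (real \<Rightarrow> real \<Rightarrow> real ^ 'n) \<Rightarrow> (real \<Rightarrow> real ^ 'n) \<Rightarrow> real \<Rightarrow> real set \<Rightarrow> bool" where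
  "K_has_derivative m \<eta> v t T \<longleftrightarrow>
     v \<in> K_space m \<and>
     ((\<lambda>r. K_norm m (\<lambda>s. (\<eta> r s - \<eta> t s) /\<^sub>R (r - t) - v s)) \<longlongrightarrow> 0) (at t within T)"

definition K_C1_on :: "nat \<Rightarrow> real set \<Rightarrow> (real \<Rightarrow> real \<Rightarrow> real ^ 'n) \<Rightarrow> bool" where
  "K_C1_on m T \<eta> \<longleftrightarrow>
     (\<exists>v. (\<forall>t\<in>T. K_has_derivative m \<eta> (v t) t T) \<and> K_continuous_on m T v)"

definition piecewise_C1_path_in_A :: "nat \<Rightarrow> (real \<Rightarrow> real \<Rightarrow> real ^ 'n) \<Rightarrow> bool" where
  "piecewise_C1_path_in_A m \<eta> \<longleftrightarrow>
     (\<forall>t\<in>{0..1}. \<eta> t \<in> A_space m) \<and>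
     (\<exists>(n::nat) \<tau>. \<tau> 0 = 0 \<and> \<tau> n = 1 \<and> (\<forall>i<n. \<tau> i < \<tau> (Suc i)) \<and>
        (\<forall>i<n. K_C1_on m {\<tau> i..\<tau> (Suc i)} \<eta>))"

text \<open>The value at the finitely many break points of a piecewise \<open>C\<^sup>1\<close> path is irrelevant for the
  length below.\<close>

definition time_deriv ::
  "nat \<Rightarrow> (real \<Rightarrow> real \<Rightarrow> real ^ 'n) \<Rightarrow> real \<Rightarrow> (real \<Rightarrow> real ^ 'n)" where
  "time_deriv m \<eta> t = (SOME v. K_has_derivative m \<eta> v t {0..1})"

text \<open>The first argument is the foot point of the tangent vectors \<open>u\<close> and \<open>v\<close>.\<close>

definition L2_metric ::
  "(real \<Rightarrow> real ^ 'n) \<Rightarrow> (real \<Rightarrow> real ^ 'n) \<Rightarrow> (real \<Rightarrow> real ^ 'n) \<Rightarrow> real" where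
  "L2_metric \<eta> u v = set_lebesgue_integral lebesgue {-1..1} (\<lambda>s. u s \<bullet> v s)"

definition path_length :: "nat \<Rightarrow> (real \<Rightarrow> real \<Rightarrow> real ^ 'n) \<Rightarrow> real" where
  "path_length m \<eta> = set_lebesgue_integral lebesgue {0..1}
     (\<lambda>t. sqrt (L2_metric (\<eta> t) (time_deriv m \<eta> t) (time_deriv m \<eta> t)))"

definition riemannian_dist ::
  "nat \<Rightarrow> (real \<Rightarrow> real ^ 'n) \<Rightarrow> (real \<Rightarrow> real ^ 'n) \<Rightarrow> ereal" where
  "riemannian_dist m \<gamma>\<^sub>1 \<gamma>\<^sub>2 =
     Inf {ereal (path_length m \<eta>) | \<eta>.
            piecewise_C1_path_in_A m \<eta> \<and> \<eta> 0 = \<gamma>\<^sub>1 \<and> \<eta> 1 = \<gamma>\<^sub>2}"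

end

theory Submission
  imports Defs
begin

text \<open>The length of a path dominates the \<open>L\<^sup>2\<close> distance of its end points. Put
  \<open>w = \<gamma>\<^sub>2 - \<gamma>\<^sub>1\<close>. Since convergence in \<open>\<K>\<^sup>m\<close> implies convergence in \<open>L\<^sup>2\<close>, the function
  \<open>t \<mapsto> \<langle>\<eta>(t), w\<rangle>\<close> is piecewise \<open>C\<^sup>1\<close> with derivative \<open>\<langle>\<eta>\<^sub>t, w\<rangle> \<le> \<parallel>w\<parallel> \<parallel>\<eta>\<^sub>t\<parallel>\<close>; integrating
  yields \<open>\<parallel>w\<parallel>\<^sup>2 \<le> \<parallel>w\<parallel> L(\<eta>)\<close>. As \<open>w\<close> is continuous and nonzero, \<open>\<parallel>w\<parallel> > 0\<close>.\<close>

section \<open>Inner product and norm of L2 on continuous curves\<close>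

definition L2_inner :: "(real \<Rightarrow> real ^ 'n) \<Rightarrow> (real \<Rightarrow> real ^ 'n) \<Rightarrow> real" where
  "L2_inner u v = integral {-1..1} (\<lambda>s. u s \<bullet> v s)"

definition L2_norm :: "(real \<Rightarrow> real ^ 'n) \<Rightarrow> real" where
  "L2_norm u = sqrt (L2_inner u u)"

lemma set_lebesgue_integral_eq_integral_continuous:
  fixes f :: "real \<Rightarrow> real"
  assumes "continuous_on {a..b} f"
  shows "set_lebesgue_integral lebesgue {a..b} f = integral {a..b} f"
  by (rule set_lebesgue_integral_eq_integral(2))
    (use absolutely_integrable_continuous_real[OF assms] in simp)

text \<open>Passes from the Lebesgue integral of the metric to the gauge integral behind
  \<open>L2_inner\<close>, for which the fundamental theorem of calculus is at hand.\<close>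

lemma L2_metric_eq_L2_inner:
  assumes "continuous_on {-1..1} u" "continuous_on {-1..1} v"
  shows "L2_metric \<eta> u v = L2_inner u v"
  unfolding L2_metric_def L2_inner_def
  by (intro set_lebesgue_integral_eq_integral_continuous continuous_intros assms)

lemma inner_integrable_on:
  fixes u v :: "real \<Rightarrow> real ^ 'n"
  assumes "continuous_on {-1..1} u" "continuous_on {-1..1} v"
  shows "(\<lambda>s. u s \<bullet> v s) integrable_on {-1..1}"
  by (intro integrable_continuous_real continuous_intros assms)

lemma L2_inner_commute: "L2_inner u v = L2_inner v u"
  by (simp add: L2_inner_def inner_commute)

lemma L2_inner_diff_left:
  assumes "continuous_on {-1..1} u" "continuous_on {-1..1} v" "continuous_on {-1..1} w"
  shows "L2_inner (\<lambda>s. u s - v s) w = L2_inner u w - L2_inner v w"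
  using assms by (simp add: L2_inner_def inner_diff_left integral_diff inner_integrable_on)

lemma L2_inner_scaleR_left: "L2_inner (\<lambda>s. c *\<^sub>R u s) w = c * L2_inner u w"
  by (simp add: L2_inner_def)

lemma L2_inner_self_nonneg: "0 \<le> L2_inner u u"
  unfolding L2_inner_def
  \<comment> \<open>A non-integrable function has \<open>integral\<close> 0 by default, so no
    continuity of \<open>u\<close> enters.\<close>
  by (cases "(\<lambda>s. u s \<bullet> u s) integrable_on {-1..1}")
    (auto intro: integral_nonneg simp: not_integrable_integral)

lemma L2_norm_nonneg: "0 \<le> L2_norm u"
  by (simp add: L2_norm_def L2_inner_self_nonneg)

lemma L2_norm_power2: "(L2_norm u)\<^sup>2 = L2_inner u u"
  by (simp add: L2_norm_def L2_inner_self_nonneg)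

text \<open>A nonnegative continuous function with integral 0 vanishes everywhere on the interval;
  this makes the L2 norm detect a difference at a single point.\<close>

lemma L2_inner_self_pos:
  assumes "continuous_on {-1..1} u" "s \<in> {-1..1}" "u s \<noteq> 0"
  shows "0 < L2_inner u u"
proof (rule ccontr)
  assume "\<not> 0 < L2_inner u u"
  then have "integral {-1..1} (\<lambda>s. u s \<bullet> u s) = 0"
    using L2_inner_self_nonneg[of u] by (simp add: L2_inner_def)
  then have "((\<lambda>s. u s \<bullet> u s) has_integral 0) (cbox (-1) 1)"
    using inner_integrable_on[OF assms(1,1)] by (simp add: has_integral_iff)
  moreover have "continuous_on (cbox (-1) 1) (\<lambda>s. u s \<bullet> u s)"
    using assms(1) by (auto intro!: continuous_intros)
  moreover have "s \<in> cbox (-1) 1" "box (-1) (1::real) \<noteq> {}"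
    using assms(2) by auto
  ultimately have "u s \<bullet> u s = 0"
    by (intro has_integral_0_cbox_imp_0[where f = "\<lambda>s. u s \<bullet> u s"]) auto
  with assms(3) show False by simp
qed

lemma L2_Cauchy_Schwarz:
  assumes "continuous_on {-1..1} u" "continuous_on {-1..1} v"
  shows "\<bar>L2_inner u v\<bar> \<le> L2_norm u * L2_norm v"
proof (cases "L2_inner v v = 0")
  case True
  then have "v s = 0" if "s \<in> {-1..1}" for s
    using L2_inner_self_pos[OF assms(2) that] by force
  then have "L2_inner u v = 0"
    unfolding L2_inner_def by (intro integral_unique has_integral_is_0) auto
  then show ?thesis by (simp add: L2_norm_nonneg)
next
  case False
  define B where "B = L2_inner v v"
  have B: "B > 0"
    using False L2_inner_self_nonneg[of v] by (simp add: B_def)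
  \<comment> \<open>The coefficient of the orthogonal projection of \<open>u\<close> onto the line
    through \<open>v\<close>; nonnegativity of \<open>L2_inner ?d ?d\<close> is then the
    Cauchy-Schwarz inequality.\<close>
  define c where "c = L2_inner u v / B"
  have cv: "continuous_on {-1..1} (\<lambda>s. c *\<^sub>R v s)"
    by (intro continuous_intros assms)
  let ?d = "\<lambda>s. u s - c *\<^sub>R v s"
  have cd: "continuous_on {-1..1} ?d"
    by (intro continuous_intros assms)
  have "L2_inner ?d ?d = L2_inner u ?d - c * L2_inner v ?d"
    using L2_inner_diff_left[OF assms(1) cv cd] by (simp add: L2_inner_scaleR_left)
  also have "L2_inner u ?d = L2_inner u u - c * L2_inner u v"
    using L2_inner_diff_left[OF assms(1) cv assms(1)]
    by (simp add: L2_inner_commute[of u ?d] L2_inner_commute[of v u] L2_inner_scaleR_left)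
  also have "L2_inner v ?d = L2_inner u v - c * B"
    using L2_inner_diff_left[OF assms(1) cv assms(2)]
    by (simp add: L2_inner_commute[of v ?d] L2_inner_scaleR_left B_def)
  finally have "0 \<le> L2_inner u u - c * L2_inner u v - c * (L2_inner u v - c * B)"
    using L2_inner_self_nonneg[of ?d] by simp
  also have "\<dots> = L2_inner u u - (L2_inner u v)\<^sup>2 / B"
    using B by (simp add: c_def power2_eq_square)
  finally have "(L2_inner u v)\<^sup>2 \<le> L2_inner u u * B"
    using B by (simp add: field_simps)
  then have "sqrt ((L2_inner u v)\<^sup>2) \<le> sqrt (L2_inner u u * B)"
    by (rule real_sqrt_le_mono)
  then show ?thesis
    by (simp add: L2_norm_def real_sqrt_mult B_def)
qed

section \<open>From convergence in the norm of \<open>K_space\<close> to convergence in L2\<close>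

lemma L2_norm_le_K_norm:
  assumes "continuous_on {-1..1} u"
  shows "L2_norm u \<le> K_norm m u"
proof -
  \<comment> \<open>The summand \<open>j = 0\<close> involves only \<open>wderiv 0 u = u\<close>.
    The others need just a sign, so nothing about the chosen weak derivatives is used.\<close>
  have "L2_inner u u = wnorm_sq 0 0 u"
    using set_lebesgue_integral_eq_integral_continuous[of "-1" 1 "\<lambda>s. (norm (u s))\<^sup>2"] assms
    by (simp add: L2_inner_def wnorm_sq_def dot_square_norm continuous_intros)
  also have "\<dots> \<le> (\<Sum>j\<le>m. wnorm_sq j j u)"
  proof (rule member_le_sum)
    fix j :: nat
    have "0 \<le> (1 - s\<^sup>2) ^ j" if "s \<in> {-1..1}" for s :: real
      using that by (intro zero_le_power) (simp add: abs_square_le_1 abs_le_iff)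
    then show "0 \<le> wnorm_sq j j u"
      unfolding wnorm_sq_def set_lebesgue_integral_def
      by (intro integral_nonneg_AE AE_I2) (auto simp: indicator_def)
  qed auto
  finally show ?thesis
    by (simp add: L2_norm_def K_norm_def)
qed

lemma L2_norm_tendsto_0_if_K_norm_tendsto_0:
  assumes "((\<lambda>r. K_norm m (q r)) \<longlongrightarrow> 0) F"
    and "\<forall>\<^sub>F r in F. continuous_on {-1..1} (q r)"
  shows "((\<lambda>r. L2_norm (q r)) \<longlongrightarrow> 0) F"
proof (rule Lim_null_comparison[OF _ assms(1)])
  show "\<forall>\<^sub>F r in F. norm (L2_norm (q r)) \<le> K_norm m (q r)"
    using assms(2) by eventually_elim (simp add: L2_norm_nonneg L2_norm_le_K_norm)
qed

text \<open>By Cauchy-Schwarz, pairing with a fixed \<open>w\<close> is Lipschitz in the L2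
  norm.\<close>

lemma L2_inner_tendsto:
  assumes lim: "((\<lambda>r. L2_norm (\<lambda>s. q r s - v s)) \<longlongrightarrow> 0) F"
    and q: "\<forall>\<^sub>F r in F. continuous_on {-1..1} (q r)"
    and v: "continuous_on {-1..1} v" and w: "continuous_on {-1..1} w"
  shows "((\<lambda>r. L2_inner (q r) w) \<longlongrightarrow> L2_inner v w) F"
proof (rule LIM_zero_cancel, rule Lim_null_comparison)
  show "\<forall>\<^sub>F r in F. norm (L2_inner (q r) w - L2_inner v w)
      \<le> L2_norm (\<lambda>s. q r s - v s) * L2_norm w"
    using q
  proof eventually_elim
    case (elim r)
    then show ?case
      using L2_Cauchy_Schwarz[of "\<lambda>s. q r s - v s" w] v w
      by (simp add: L2_inner_diff_left continuous_on_diff)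
  qed
  show "((\<lambda>r. L2_norm (\<lambda>s. q r s - v s) * L2_norm w) \<longlongrightarrow> 0) F"
    using tendsto_mult_right[OF lim, of "L2_norm w"] by simp
qed

lemma L2_norm_tendsto:
  assumes lim: "((\<lambda>r. L2_norm (\<lambda>s. q r s - v s)) \<longlongrightarrow> 0) F"
    and q: "\<forall>\<^sub>F r in F. continuous_on {-1..1} (q r)"
    and v: "continuous_on {-1..1} v"
  shows "((\<lambda>r. L2_norm (q r)) \<longlongrightarrow> L2_norm v) F"
proof -
  \<comment> \<open>Expanding the square of \<open>q r - v\<close> writes the squared norm of
    \<open>q r\<close> through terms whose limits are known.\<close>
  have "((\<lambda>r. (L2_norm (\<lambda>s. q r s - v s))\<^sup>2 + 2 * L2_inner (q r) v - L2_inner v v)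
      \<longlongrightarrow> 0\<^sup>2 + 2 * L2_inner v v - L2_inner v v) F"
    by (intro tendsto_intros lim L2_inner_tendsto q v)
  moreover have "\<forall>\<^sub>F r in F. (L2_norm (\<lambda>s. q r s - v s))\<^sup>2 + 2 * L2_inner (q r) v - L2_inner v v
      = L2_inner (q r) (q r)"
    using q
  proof eventually_elim
    case (elim r)
    note d = continuous_on_diff[OF elim v]
    show ?case
      using L2_inner_diff_left[OF elim v d] L2_inner_diff_left[OF elim v elim]
        L2_inner_diff_left[OF elim v v]
      by (simp add: L2_norm_power2 L2_inner_commute[of "q r" "\<lambda>s. q r s - v s"]
          L2_inner_commute[of v "\<lambda>s. q r s - v s"] L2_inner_commute[of v "q r"])
  qed
  ultimately have "((\<lambda>r. L2_inner (q r) (q r)) \<longlongrightarrow> L2_inner v v) F"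
    by (simp add: tendsto_cong)
  then show ?thesis
    unfolding L2_norm_def by (rule tendsto_real_sqrt)
qed

section \<open>Time derivatives tested against a fixed curve\<close>

lemma K_space_continuous_on: "\<eta> \<in> K_space m \<Longrightarrow> continuous_on {-1..1} \<eta>"
  by (simp add: K_space_def)

lemma A_space_continuous_on: "\<eta> \<in> A_space m \<Longrightarrow> continuous_on {-1..1} \<eta>"
  by (auto simp: A_space_def intro: K_space_continuous_on)

lemma K_has_derivative_continuous_on:
  "K_has_derivative m \<eta> v t T \<Longrightarrow> continuous_on {-1..1} v"
  by (auto simp: K_has_derivative_def intro: K_space_continuous_on)

lemma K_has_derivative_imp_L2_inner_tendsto:
  assumes D: "K_has_derivative m \<eta> v t T"
    and \<eta>: "\<And>r. r \<in> T \<Longrightarrow> continuous_on {-1..1} (\<eta> r)" and t: "t \<in> T"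
    and w: "continuous_on {-1..1} w"
  shows "((\<lambda>r. L2_inner (\<lambda>s. (\<eta> r s - \<eta> t s) /\<^sub>R (r - t)) w) \<longlongrightarrow> L2_inner v w) (at t within T)"
proof (rule L2_inner_tendsto[OF _ _ K_has_derivative_continuous_on[OF D] w])
  have c: "\<forall>\<^sub>F r in at t within T. continuous_on {-1..1} (\<lambda>s. (\<eta> r s - \<eta> t s) /\<^sub>R (r - t))"
    unfolding eventually_at_filter
    by (intro always_eventually allI impI continuous_intros \<eta> t)
  then show "\<forall>\<^sub>F r in at t within T. continuous_on {-1..1} (\<lambda>s. (\<eta> r s - \<eta> t s) /\<^sub>R (r - t))" .
  show "((\<lambda>r. L2_norm (\<lambda>s. (\<eta> r s - \<eta> t s) /\<^sub>R (r - t) - v s)) \<longlongrightarrow> 0) (at t within T)"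
  proof (rule L2_norm_tendsto_0_if_K_norm_tendsto_0)
    show "((\<lambda>r. K_norm m (\<lambda>s. (\<eta> r s - \<eta> t s) /\<^sub>R (r - t) - v s)) \<longlongrightarrow> 0) (at t within T)"
      using D by (simp add: K_has_derivative_def)
    show "\<forall>\<^sub>F r in at t within T. continuous_on {-1..1} (\<lambda>s. (\<eta> r s - \<eta> t s) /\<^sub>R (r - t) - v s)"
      using c by eventually_elim
        (rule continuous_on_diff[OF _ K_has_derivative_continuous_on[OF D]])
  qed
qed

text \<open>Pairing with \<open>w\<close> is linear, hence commutes with difference quotients; this
  reduces differentiation of paths to calculus of real functions.\<close>

lemma K_has_derivative_imp_has_vector_derivative:
  assumes D: "K_has_derivative m \<eta> v t T"
    and \<eta>: "\<And>r. r \<in> T \<Longrightarrow> continuous_on {-1..1} (\<eta> r)" and t: "t \<in> T"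
    and w: "continuous_on {-1..1} w"
  shows "((\<lambda>r. L2_inner (\<eta> r) w) has_vector_derivative L2_inner v w) (at t within T)"
proof -
  have "\<forall>\<^sub>F r in at t within T. L2_inner (\<lambda>s. (\<eta> r s - \<eta> t s) /\<^sub>R (r - t)) w
      = (L2_inner (\<eta> r) w - L2_inner (\<eta> t) w) / (r - t)"
    unfolding eventually_at_filter
    by (intro always_eventually)
      (simp add: L2_inner_scaleR_left L2_inner_diff_left \<eta> t w divide_inverse_commute)
  then have "((\<lambda>r. (L2_inner (\<eta> r) w - L2_inner (\<eta> t) w) / (r - t)) \<longlongrightarrow> L2_inner v w)
      (at t within T)"
    using K_has_derivative_imp_L2_inner_tendsto[OF assms] by (simp add: tendsto_cong)
  then show ?thesis
    by (simp add: has_field_derivative_iff flip: has_real_derivative_iff_has_vector_derivative)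
qed

text \<open>Needed because \<open>time_deriv\<close> selects a derivative by \<open>SOME\<close>:
  the speed must not depend on the choice.\<close>

lemma K_has_derivative_L2_norm_unique:
  assumes D: "K_has_derivative m \<eta> u t T" "K_has_derivative m \<eta> v t T"
    and \<eta>: "\<And>r. r \<in> T \<Longrightarrow> continuous_on {-1..1} (\<eta> r)" and t: "t \<in> T"
    and nontrivial: "at t within T \<noteq> bot"
  shows "L2_norm u = L2_norm v"
proof -
  have eq: "L2_inner u w = L2_inner v w" if "continuous_on {-1..1} w" for w
    using K_has_derivative_imp_L2_inner_tendsto[OF D(1) \<eta> t that]
      K_has_derivative_imp_L2_inner_tendsto[OF D(2) \<eta> t that]
    by (rule tendsto_unique[OF nontrivial])
  \<comment> \<open>Testing with \<open>u\<close> and with \<open>v\<close> shows that both sides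
    equal \<open>L2_inner u v\<close>.\<close>
  have "L2_inner u u = L2_inner v v"
    using eq[of u] eq[of v] D by (metis K_has_derivative_continuous_on L2_inner_commute)
  then show ?thesis by (simp add: L2_norm_def)
qed

section \<open>Speed, and the estimate on one smooth piece\<close>

definition speed :: "nat \<Rightarrow> (real \<Rightarrow> real \<Rightarrow> real ^ 'n) \<Rightarrow> real \<Rightarrow> real" where
  "speed m \<eta> t = sqrt (L2_metric (\<eta> t) (time_deriv m \<eta> t) (time_deriv m \<eta> t))"

lemma speed_nonneg: "0 \<le> speed m \<eta> t"
  unfolding speed_def L2_metric_def set_lebesgue_integral_def
  by (auto intro!: integral_nonneg_AE)

text \<open>At an interior point of a piece, the filters within \<open>{a..b}\<close> and within
  \<open>{0..1}\<close> are both \<open>at t\<close>, so the derivative along the piece is also one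
  along the whole path. At a break point the one-sided derivatives may differ.\<close>

lemma speed_eq_L2_norm:
  assumes D: "K_has_derivative m \<eta> v t {a..b}" and t: "a < t" "t < b" and ab: "0 \<le> a" "b \<le> 1"
    and \<eta>: "\<And>r. r \<in> {0..1} \<Longrightarrow> continuous_on {-1..1} (\<eta> r)"
  shows "speed m \<eta> t = L2_norm v"
proof -
  have "at t within {a..b} = at t" "at t within {0..1} = at t"
    using t ab by (auto intro!: at_within_interior)
  with D have D': "K_has_derivative m \<eta> v t {0..1}"
    and nontrivial: "at t within {0..1} \<noteq> bot"
    by (simp_all add: K_has_derivative_def)
  from D' have "K_has_derivative m \<eta> (time_deriv m \<eta> t) t {0..1}"
    unfolding time_deriv_def by (rule someI[where P = "\<lambda>v. K_has_derivative m \<eta> v t {0..1}"])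
  note K_has_derivative_L2_norm_unique[OF this D' \<eta> _ nontrivial]
    and K_has_derivative_continuous_on[OF this]
  then show ?thesis
    using t ab by (simp add: speed_def L2_metric_eq_L2_inner L2_norm_def)
qed

text \<open>The fundamental theorem of calculus for the pairing with \<open>w\<close>, with
  Cauchy-Schwarz under the integral. The same \<open>w\<close> will serve all pieces, so that the
  increments telescope.\<close>

lemma L2_inner_increment_le_length:
  assumes C1: "K_C1_on m {a..b} \<eta>" and ab: "0 \<le> a" "a \<le> b" "b \<le> 1"
    and \<eta>: "\<And>r. r \<in> {0..1} \<Longrightarrow> continuous_on {-1..1} (\<eta> r)"
    and w: "continuous_on {-1..1} w"
  shows "speed m \<eta> integrable_on {a..b}"
    and "L2_inner (\<eta> b) w - L2_inner (\<eta> a) w \<le> L2_norm w * integral {a..b} (speed m \<eta>)"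
proof -
  from C1 obtain v where D: "\<And>t. t \<in> {a..b} \<Longrightarrow> K_has_derivative m \<eta> (v t) t {a..b}"
    and v: "K_continuous_on m {a..b} v"
    unfolding K_C1_on_def by blast
  have \<eta>': "\<And>r. r \<in> {a..b} \<Longrightarrow> continuous_on {-1..1} (\<eta> r)"
    using \<eta> ab by simp
  have cv: "continuous_on {-1..1} (v t)" if "t \<in> {a..b}" for t
    using K_has_derivative_continuous_on[OF D[OF that]] .
  have "continuous_on {a..b} (\<lambda>t. L2_norm (v t))"
    unfolding continuous_on_def
  proof
    fix t assume t: "t \<in> {a..b}"
    show "((\<lambda>t. L2_norm (v t)) \<longlongrightarrow> L2_norm (v t)) (at t within {a..b})"
    proof (rule L2_norm_tendsto[OF L2_norm_tendsto_0_if_K_norm_tendsto_0[where m = m] _ cv[OF t]])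
      show "((\<lambda>r. K_norm m (\<lambda>s. v r s - v t s)) \<longlongrightarrow> 0) (at t within {a..b})"
        using v t by (simp add: K_continuous_on_def)
      show "\<forall>\<^sub>F r in at t within {a..b}. continuous_on {-1..1} (v r)"
        unfolding eventually_at_filter by (intro always_eventually allI impI cv)
      show "\<forall>\<^sub>F r in at t within {a..b}. continuous_on {-1..1} (\<lambda>s. v r s - v t s)"
        unfolding eventually_at_filter
        by (intro always_eventually allI impI continuous_on_diff cv t)
    qed
  qed
  then have int: "((\<lambda>t. L2_norm (v t)) has_integral integral {a..b} (\<lambda>t. L2_norm (v t))) {a..b}"
    by (intro integrable_integral integrable_continuous_real)
  \<comment> \<open>The speed is known only inside the piece; the two end points do not affect the
    integral.\<close>
  have speed: "(speed m \<eta> has_integral integral {a..b} (\<lambda>t. L2_norm (v t))) {a..b}"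
  proof (rule has_integral_spike_finite[OF _ _ int])
    show "finite {a, b}" by simp
    show "speed m \<eta> t = L2_norm (v t)" if "t \<in> {a..b} - {a, b}" for t
      using that ab by (intro speed_eq_L2_norm[OF D _ _ _ _ \<eta>]) auto
  qed
  then show "speed m \<eta> integrable_on {a..b}" by blast
  have "((\<lambda>t. L2_inner (v t) w) has_integral L2_inner (\<eta> b) w - L2_inner (\<eta> a) w) {a..b}"
    using ab
    by (intro fundamental_theorem_of_calculus K_has_derivative_imp_has_vector_derivative[OF D \<eta>' _ w])
      auto
  then have "L2_inner (\<eta> b) w - L2_inner (\<eta> a) w
      \<le> L2_norm w * integral {a..b} (\<lambda>t. L2_norm (v t))"
  proof (rule has_integral_le)
    show "((\<lambda>t. L2_norm w * L2_norm (v t)) has_integral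
        L2_norm w * integral {a..b} (\<lambda>t. L2_norm (v t))) {a..b}"
      using int by (rule has_integral_mult_right)
    show "L2_inner (v t) w \<le> L2_norm w * L2_norm (v t)" if "t \<in> {a..b}" for t
      using L2_Cauchy_Schwarz[OF cv[OF that] w] by (simp add: mult.commute)
  qed
  then show "L2_inner (\<eta> b) w - L2_inner (\<eta> a) w \<le> L2_norm w * integral {a..b} (speed m \<eta>)"
    using speed by (simp add: integral_unique)
qed

section \<open>Summation over the pieces, and positivity of the distance\<close>

lemma L2_norm_diff_le_path_length:
  assumes "piecewise_C1_path_in_A m \<eta>"
  shows "L2_norm (\<lambda>s. \<eta> 1 s - \<eta> 0 s) \<le> path_length m \<eta>"
proof -
  define w where "w = (\<lambda>s. \<eta> 1 s - \<eta> 0 s)"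
  from assms obtain n \<tau> where ends: "\<tau> 0 = 0" "\<tau> n = 1"
    and less: "\<And>i. i < n \<Longrightarrow> \<tau> i < \<tau> (Suc i)"
    and C1: "\<And>i. i < n \<Longrightarrow> K_C1_on m {\<tau> i..\<tau> (Suc i)} \<eta>"
    and A: "\<And>t. t \<in> {0..1} \<Longrightarrow> \<eta> t \<in> A_space m"
    unfolding piecewise_C1_path_in_A_def by blast
  have \<eta>: "continuous_on {-1..1} (\<eta> t)" if "t \<in> {0..1}" for t
    using A[OF that] by (rule A_space_continuous_on)
  then have w: "continuous_on {-1..1} w"
    unfolding w_def by (intro continuous_on_diff) auto
  have mono: "\<tau> i \<le> \<tau> j" if "i \<le> j" "j \<le> n" for i j
    using that
  proof (induction j rule: dec_induct)
    case (step k)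
    then show ?case using less[of k] by simp
  qed simp
  \<comment> \<open>Induction over the break points; integrability is carried along so that the
    integrals over adjacent pieces can be added.\<close>
  have "speed m \<eta> integrable_on {0..\<tau> k} \<and>
      L2_inner (\<eta> (\<tau> k)) w - L2_inner (\<eta> 0) w \<le> L2_norm w * integral {0..\<tau> k} (speed m \<eta>)"
    if "k \<le> n" for k
    using that
  proof (induction k)
    case 0
    then show ?case using integrable_on_refl[of "speed m \<eta>" 0] by (simp add: ends)
  next
    case (Suc k)
    have \<tau>: "0 \<le> \<tau> k" "\<tau> k \<le> \<tau> (Suc k)" "\<tau> (Suc k) \<le> 1"
      using mono[of 0 k] mono[of k "Suc k"] mono[of "Suc k" n] Suc.prems by (auto simp: ends)
    have "k < n" using Suc.prems by simp
    note piece = L2_inner_increment_le_length[OF C1[OF this] \<tau> \<eta> w]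
    note IH = Suc.IH[OF less_imp_le[OF \<open>k < n\<close>]]
    have int: "speed m \<eta> integrable_on {0..\<tau> (Suc k)}"
      by (rule Henstock_Kurzweil_Integration.integrable_combine[OF \<tau>(1,2) conjunct1[OF IH] piece(1)])
    have "integral {0..\<tau> k} (speed m \<eta>) + integral {\<tau> k..\<tau> (Suc k)} (speed m \<eta>)
        = integral {0..\<tau> (Suc k)} (speed m \<eta>)"
      by (rule Henstock_Kurzweil_Integration.integral_combine[OF \<tau>(1,2) int])
    then have "L2_norm w * integral {0..\<tau> (Suc k)} (speed m \<eta>)
        = L2_norm w * integral {0..\<tau> k} (speed m \<eta>)
          + L2_norm w * integral {\<tau> k..\<tau> (Suc k)} (speed m \<eta>)"
      by (simp flip: distrib_left)
    with int IH piece(2) show ?case by linarith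
  qed
  from this[of n] have int: "speed m \<eta> integrable_on {0..1}"
    and le: "L2_inner (\<eta> 1) w - L2_inner (\<eta> 0) w \<le> L2_norm w * integral {0..1} (speed m \<eta>)"
    by (simp_all add: ends)
  \<comment> \<open>Nonnegativity upgrades gauge integrability to Lebesgue integrability, so
    \<open>path_length\<close> is the true integral and not the default value 0.\<close>
  have "speed m \<eta> absolutely_integrable_on {0..1}"
    using int by (intro nonnegative_absolutely_integrable_1) (auto simp: speed_nonneg)
  then have length: "path_length m \<eta> = integral {0..1} (speed m \<eta>)"
    unfolding path_length_def speed_def[symmetric] by (rule set_lebesgue_integral_eq_integral(2))
  have "(L2_norm w)\<^sup>2 = L2_inner (\<eta> 1) w - L2_inner (\<eta> 0) w"
    using L2_inner_diff_left[OF \<eta>[of 1] \<eta>[of 0] w] by (simp add: L2_norm_power2 w_def)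
  with le length have "L2_norm w * L2_norm w \<le> L2_norm w * path_length m \<eta>"
    by (simp add: power2_eq_square)
  \<comment> \<open>Settles the case \<open>L2_norm w = 0\<close>, where the factor cannot be
    cancelled.\<close>
  moreover have "0 \<le> path_length m \<eta>"
    unfolding length using int by (intro integral_nonneg) (auto simp: speed_nonneg)
  ultimately show ?thesis
    using L2_norm_nonneg[of w] unfolding w_def[symmetric]
    by (cases "L2_norm w = 0") auto
qed

theorem proposition4p3:
  fixes m :: nat and \<gamma>\<^sub>1 \<gamma>\<^sub>2 :: "real \<Rightarrow> real ^ 'n"
  assumes "CARD('n) \<ge> 2" and "m \<ge> 4"
    and "\<gamma>\<^sub>1 \<in> A_space m" and "\<gamma>\<^sub>2 \<in> A_space m" and "\<gamma>\<^sub>1 \<noteq> \<gamma>\<^sub>2"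
  shows "0 < riemannian_dist m \<gamma>\<^sub>1 \<gamma>\<^sub>2"
proof -
  let ?w = "\<lambda>s. \<gamma>\<^sub>2 s - \<gamma>\<^sub>1 s"
  from assms(5) obtain s where s: "\<gamma>\<^sub>1 s \<noteq> \<gamma>\<^sub>2 s" by blast
  \<comment> \<open>Both curves vanish off the interval, so they can differ only inside it.\<close>
  then have "s \<in> {-1..1}"
    using assms(3,4) unfolding A_space_def K_space_def by force
  moreover have "continuous_on {-1..1} ?w"
    using assms(3,4) by (intro continuous_on_diff A_space_continuous_on)
  ultimately have "0 < L2_norm ?w"
    using s L2_inner_self_pos[of ?w s] by (simp add: L2_norm_def)
  then have "0 < ereal (L2_norm ?w)" by simp
  \<comment> \<open>The bound is the same for every admissible path; if there is none, the infimum
    is \<infinity>.\<close>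
  also have "\<dots> \<le> riemannian_dist m \<gamma>\<^sub>1 \<gamma>\<^sub>2"
    unfolding riemannian_dist_def
    by (rule Inf_greatest) (auto dest: L2_norm_diff_le_path_length)
  finally show ?thesis .
qed

end
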